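(* Let $Z$ be an exponential random variable with mean one. Let $W\ge 0$ be a random variable with finite second moment, and let $(W,W')$ be an exchangeable pair such that, for some constant $a>0$ and some sigma-field $\mathcal{F}\supseteq\sigma(W)$, $$\mathbb{E}[W'-W\mid\mathcal{F}]=-a(W-1)+R,$$ where $R$ is a random variable (defined by this identity). Then for all $\delta>0$, $$d_K(W,Z)\le \frac{8}{\delta}\,\mathbb{E}\left|W-\frac{\mathbb{E}[(W'-W)^2\mid\mathcal{F}]}{2a}\right|+\frac{2}{\delta}\,|\mathbb{E}W-1|+\left(\frac{5-6/e}{\delta}+\frac{3}{\delta^2}\right)\frac{\mathbb{E}|W'-W|^3}{a}+\frac{8}{\delta}\,\frac{\mathbb{E}|R|}{a}+\frac{\delta}{2}.$$
   Context: The pair $(W,W')$ of random variables on a common probability space is exchangeable if $(W,W')$ and $(W',W)$ have the same joint distribution. The Kolmogorov distance between (the laws of) real random variables $W$ and $Z$ is $d_K(W,Z)=\sup_{t\in\mathbb{R}}|\mathbb{P}(W\le t)-\mathbb{P}(Z\le t)|$. *)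

theory Defs
  imports "HOL-Probability.Probability"
begin

definition exchangeable_pair :: "'a measure \<Rightarrow> ('a \<Rightarrow> real) \<Rightarrow> ('a \<Rightarrow> real) \<Rightarrow> bool" where
  "exchangeable_pair M W W' \<longleftrightarrow>
     W \<in> borel_measurable M \<and> W' \<in> borel_measurable M \<and>
     distr M (borel \<Otimes>\<^sub>M borel) (\<lambda>x. (W x, W' x)) =
     distr M (borel \<Otimes>\<^sub>M borel) (\<lambda>x. (W' x, W x))"

text \<open>The two random variables may live on different probability spaces, since only their laws
  matter. The supremum is taken over a set of reals in the interval from 0 to 1.\<close>

definition kolmogorov_dist ::
  "'a measure \<Rightarrow> ('a \<Rightarrow> real) \<Rightarrow> 'b measure \<Rightarrow> ('b \<Rightarrow> real) \<Rightarrow> real" where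
  "kolmogorov_dist M W N Z =
     (SUP t::real. \<bar>measure M {x \<in> space M. W x \<le> t} - measure N {y \<in> space N. Z y \<le> t}\<bar>)"

text \<open>Expectation with values in the extended nonnegative reals, for nonnegative \<open>X\<close>: it is infinite,
  rather than 0 as for the Bochner integral, if \<open>X\<close> is not integrable. (Negative values of \<open>X\<close> are
  truncated to 0, so this is only meaningful for nonnegative \<open>X\<close>.)\<close>

definition nn_expectation :: "'a measure \<Rightarrow> ('a \<Rightarrow> real) \<Rightarrow> ennreal" where
  "nn_expectation M X = (\<integral>\<^sup>+ x. ennreal (X x) \<partial>M)"

end

theory Submission
  imports Defs
begin

text \<open>Stein's method with the equation \<open>x g'(x) - (x - 1) g(x) = h(x) - E h(Z)\<close>. For a decreasing \<open>h\<close>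
  that falls from \<open>1\<close> to \<open>0\<close> smoothly, with \<open>\<bar>h'\<bar> \<le> K\<^sub>1\<close> and \<open>\<bar>h''\<bar> \<le> K\<^sub>2\<close>, the solution satisfies
  \<open>\<bar>g\<bar> \<le> K\<^sub>1\<close>, \<open>\<bar>g'\<bar> \<le> 2 K\<^sub>1\<close> and \<open>\<bar>g''\<bar> \<le> 2 (K\<^sub>2 + 4 K\<^sub>1)\<close>. If \<open>G' = g\<close>, exchangeability gives
  \<open>E (G(W') - G(W)) = 0\<close>; a Taylor expansion to third order and conditioning on \<open>F\<close> then bound
  \<open>E (W g'(W) - (W - 1) g(W)) = E h(W) - E h(Z)\<close> by the three error terms. Finally the indicator of
  \<open>(-\<infinity>, t]\<close> is sandwiched between two such \<open>h\<close> that fall over an interval of length \<open>\<delta>\<close>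
  (\<open>K\<^sub>1 = 2/\<delta>\<close>, \<open>K\<^sub>2 = 2 \<pi>/\<delta>\<^sup>2\<close>); their symmetry about the midpoint makes the smoothing cost at most
  \<open>\<delta>/2\<close>, since the exponential density is at most \<open>1\<close>.\<close>

subsection \<open>Comparison of functions through their derivatives\<close>

lemma nonneg_of_deriv_at_right:
  fixes f :: "real \<Rightarrow> real"
  assumes "(f \<longlongrightarrow> 0) (at_right 0)"
    and "\<And>x. 0 < x \<Longrightarrow> (f has_real_derivative f' x) (at x)"
    and "\<And>x. 0 < x \<Longrightarrow> 0 \<le> f' x"
    and "0 < x"
  shows "0 \<le> f x"
proof (rule tendsto_upperbound[OF assms(1)])
  have "f y \<le> f x" if "0 < y" "y < x" for y
  proof (rule DERIV_nonneg_imp_nondecreasing[of y x f])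
    show "\<exists>d. (f has_real_derivative d) (at z) \<and> 0 \<le> d" if "y \<le> z" for z
      using assms(2,3)[of z] \<open>0 < y\<close> that by auto
  qed (use that in simp)
  then show "\<forall>\<^sub>F y in at_right 0. f y \<le> f x"
    using \<open>0 < x\<close> by (auto simp: eventually_at_right intro!: exI[of _ x])
qed simp

lemma nonneg_of_deriv_at_top:
  fixes f :: "real \<Rightarrow> real"
  assumes "(f \<longlongrightarrow> 0) at_top"
    and "\<And>y. x \<le> y \<Longrightarrow> (f has_real_derivative f' y) (at y)"
    and "\<And>y. x \<le> y \<Longrightarrow> f' y \<le> 0"
  shows "0 \<le> f x"
proof (rule tendsto_upperbound[OF assms(1)])
  have "f y \<le> f x" if "x \<le> y" for y
  proof (rule DERIV_nonpos_imp_nonincreasing[of x y f])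
    show "\<exists>d. (f has_real_derivative d) (at z) \<and> d \<le> 0" if "x \<le> z" for z
      using assms(2,3)[of z] that by auto
  qed (use that in simp)
  then show "\<forall>\<^sub>F y in at_top. f y \<le> f x"
    by (auto simp: eventually_at_top_linorder)
qed simp

text \<open>The monotonicity criterion at \<open>0\<close> is applied to \<open>g - f\<close> and
  \<open>g + f\<close>. This integrates a bound on a derivative from \<open>0\<close> without any
  integral. Limits at \<open>0\<close> replace values there, as the derivatives are controlled on
  the open half line only.\<close>

lemma abs_le_of_deriv_at_right:
  fixes f g :: "real \<Rightarrow> real"
  assumes "(f \<longlongrightarrow> 0) (at_right 0)" "(g \<longlongrightarrow> 0) (at_right 0)"
    and "\<And>x. 0 < x \<Longrightarrow> (f has_real_derivative f' x) (at x)"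
    and "\<And>x. 0 < x \<Longrightarrow> (g has_real_derivative g' x) (at x)"
    and "\<And>x. 0 < x \<Longrightarrow> \<bar>f' x\<bar> \<le> g' x"
    and "0 < x"
  shows "\<bar>f x\<bar> \<le> g x"
proof -
  have "0 \<le> g x - f x"
    using assms(5) by (intro nonneg_of_deriv_at_right[where f = "\<lambda>x. g x - f x" and f' = "\<lambda>x. g' x - f' x"])
      (auto intro!: tendsto_eq_intros derivative_intros assms(1-4,6) simp: abs_le_iff)
  moreover have "0 \<le> g x + f x"
    using assms(5) by (intro nonneg_of_deriv_at_right[where f = "\<lambda>x. g x + f x" and f' = "\<lambda>x. g' x + f' x"])
      (force intro!: tendsto_eq_intros derivative_intros assms(1-4,6) simp: abs_le_iff)+
  ultimately show ?thesis by auto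
qed

text \<open>Integration from infinity: \<open>g\<close> decreases to \<open>0\<close> with
  derivative \<open>- g'\<close>, so \<open>g x\<close> plays the role of the integral of
  \<open>g'\<close> over (x, infinity).\<close>

lemma abs_le_of_deriv_at_top:
  fixes f g :: "real \<Rightarrow> real"
  assumes "(f \<longlongrightarrow> 0) at_top" "(g \<longlongrightarrow> 0) at_top"
    and "\<And>x. 0 < x \<Longrightarrow> (f has_real_derivative f' x) (at x)"
    and "\<And>x. 0 < x \<Longrightarrow> (g has_real_derivative - g' x) (at x)"
    and "\<And>x. 0 < x \<Longrightarrow> \<bar>f' x\<bar> \<le> g' x"
    and "0 < x"
  shows "\<bar>f x\<bar> \<le> g x"
proof -
  have "0 \<le> g x - f x"
  proof (rule nonneg_of_deriv_at_top[where f = "\<lambda>x. g x - f x" and f' = "\<lambda>x. - g' x - f' x"])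
    fix y assume "x \<le> y"
    with \<open>0 < x\<close> have "0 < y" by simp
    then show "((\<lambda>x. g x - f x) has_real_derivative - g' y - f' y) (at y)"
      by (intro derivative_intros assms(3,4))
    show "- g' y - f' y \<le> 0" using assms(5)[OF \<open>0 < y\<close>] by linarith
  qed (auto intro!: tendsto_eq_intros assms(1,2))
  moreover have "0 \<le> g x + f x"
  proof (rule nonneg_of_deriv_at_top[where f = "\<lambda>x. g x + f x" and f' = "\<lambda>x. - g' x + f' x"])
    fix y assume "x \<le> y"
    with \<open>0 < x\<close> have "0 < y" by simp
    then show "((\<lambda>x. g x + f x) has_real_derivative - g' y + f' y) (at y)"
      by (intro derivative_intros assms(3,4))
    show "- g' y + f' y \<le> 0" using assms(5)[OF \<open>0 < y\<close>] by linarith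
  qed (auto intro!: tendsto_eq_intros assms(1,2))
  ultimately show ?thesis by auto
qed

text \<open>Extends a profile on [0, 1] by constants without losing differentiability. At the two
  corners each difference quotient of the clamped function is either zero or that of
  \<open>f\<close>, whose limit \<open>f' x\<close> is zero.\<close>

lemma DERIV_clamp:
  fixes f :: "real \<Rightarrow> real"
  assumes f: "\<And>x. (f has_real_derivative f' x) (at x)" and "f' 0 = 0" "f' 1 = 0"
  shows "((\<lambda>x. f (max 0 (min 1 x))) has_real_derivative f' (max 0 (min 1 x))) (at x)"
proof -
  let ?c = "\<lambda>x::real. max 0 (min 1 x)"
  consider "x < 0" | "x > 1" | "0 < x" "x < 1" | "x = 0 \<or> x = 1" by linarith
  then show ?thesis
  proof cases
    case 1
    then have "\<forall>\<^sub>F y in nhds x. f (?c y) = f 0"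
      by (intro eventually_nhds_in_open[of "{..<0}", THEN eventually_mono]) (auto simp: max_def min_def)
    then show ?thesis
      using 1 assms by (subst DERIV_cong_ev[OF refl _ refl]) auto
  next
    case 2
    then have "\<forall>\<^sub>F y in nhds x. f (?c y) = f 1"
      by (intro eventually_nhds_in_open[of "{1<..}", THEN eventually_mono]) (auto simp: max_def min_def)
    then show ?thesis
      using 2 assms by (subst DERIV_cong_ev[OF refl _ refl]) auto
  next
    case 3
    then have "\<forall>\<^sub>F y in nhds x. f (?c y) = f y"
      by (intro eventually_nhds_in_open[of "{0<..<1}", THEN eventually_mono]) (auto simp: max_def min_def)
    then show ?thesis
      using 3 f[of x] by (subst DERIV_cong_ev[OF refl _ refl]) auto
  next
    case 4
    then have x: "f' x = 0" "?c x = x" using assms by auto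
    have "\<forall>\<^sub>F y in at x. ?c y = x \<or> ?c y = y"
      by (rule eventually_at_filter[THEN iffD2],
          rule eventually_mono[OF eventually_nhds_in_open[of "{x - 1<..<x + 1}"]])
        (use 4 in \<open>auto simp: max_def min_def\<close>)
    then have "\<forall>\<^sub>F y in at x. norm ((f (?c y) - f (?c x)) / (y - x)) \<le> \<bar>(f y - f x) / (y - x)\<bar>"
      by (rule eventually_mono) (use x(2) in auto)
    moreover have "((\<lambda>y. \<bar>(f y - f x) / (y - x)\<bar>) \<longlongrightarrow> 0) (at x)"
      using tendsto_rabs[OF f[of x, unfolded has_field_derivative_iff]] x by simp
    ultimately have "((\<lambda>y. (f (?c y) - f (?c x)) / (y - x)) \<longlongrightarrow> 0) (at x)"
      by (rule Lim_null_comparison)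
    then show ?thesis by (simp add: has_field_derivative_iff x)
  qed
qed

subsection \<open>The Stein equation of the exponential distribution\<close>

text \<open>The left end \<open>a\<close> is extended real so that the lemma serves both the whole
  line, for h exp(-x), and the half line, for the Stein solution.\<close>

lemma continuous_antiderivative:
  fixes f :: "real \<Rightarrow> real" and a :: ereal and p :: real
  assumes "a < \<infinity>" and "\<And>x. a < ereal x \<Longrightarrow> isCont f x"
  obtains F where "\<And>x. a < ereal x \<Longrightarrow> (F has_real_derivative f x) (at x)" and "F p = 0"
proof -
  obtain F where F: "\<And>x. a < ereal x \<Longrightarrow> (F has_real_derivative f x) (at x)"
    using einterval_antiderivative[of a \<infinity> f] assms
    by (auto simp: has_real_derivative_iff_has_vector_derivative)
  show thesis
    by (rule that[of "\<lambda>x. F x - F p"]) (auto intro!: derivative_eq_intros F)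
qed

text \<open>Here \<open>x\<^sup>2 / 2\<close> bounds the integral of \<open>u exp (-u)\<close> over \<open>(0, x)\<close>, and \<open>(1 + x) exp (-x)\<close> is its
  integral over \<open>(x, \<infinity>)\<close>; likewise for \<open>u\<^sup>2 exp (-u)\<close> in the next lemma. For small \<open>x\<close> one integrates
  from \<open>0\<close>, for large \<open>x\<close> from \<open>\<infinity>\<close>.\<close>

lemma quadratic_weight_disj:
  fixes x :: real
  assumes "0 < x"
  shows "x\<^sup>2 / 2 \<le> 2 * (x\<^sup>2 * exp (- x)) \<or> (1 + x) * exp (- x) \<le> 2 * (x\<^sup>2 * exp (- x))"
proof (cases "x \<le> 1")
  case True
  then have "exp x \<le> exp 1" by simp
  also have "\<dots> \<le> 3" by (rule exp_le)
  finally have "1 \<le> 4 * exp (- x)" by (simp add: exp_minus field_simps)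
  then have "x\<^sup>2 * 1 \<le> x\<^sup>2 * (4 * exp (- x))" by (intro mult_left_mono) auto
  then show ?thesis by simp
next
  case False
  then have "1 \<le> x" by simp
  then have "1 * x \<le> x * x" "1 * 1 \<le> x * x" by (intro mult_mono; simp)+
  then have "1 + x \<le> 2 * x\<^sup>2" by (simp add: power2_eq_square)
  then have "(1 + x) * exp (- x) \<le> 2 * x\<^sup>2 * exp (- x)" by (intro mult_right_mono) auto
  then show ?thesis by simp
qed

lemma cubic_weight_disj:
  fixes x :: real
  assumes "0 < x"
  shows "x^3 / 3 \<le> 2 * (x^3 * exp (- x)) \<or>
    (x\<^sup>2 + 2 * x + 2) * exp (- x) \<le> 2 * (x^3 * exp (- x))"
proof (cases "x \<le> 8/5")
  case True
  \<comment> \<open>The cut 8/5 suits both regimes: 3^8 = 6561 <= 7776 = 6^5 yields exp (8/5) <= 6,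
    as the integral from 0 requires, while x^2 + 2 x + 2 <= 2 x^3 holds from 8/5 on.\<close>
  have "exp (8/5::real) ^ 5 = exp 1 ^ 8" by (simp flip: exp_of_nat_mult)
  also have "\<dots> \<le> 3 ^ 8" by (intro power_mono exp_le) auto
  also have "\<dots> \<le> 6 ^ 5" by simp
  finally have "exp (8/5::real) \<le> 6" by (rule power_le_imp_le_base[where n = 4, simplified]) simp
  with True have "exp x \<le> 6" by (meson exp_le_cancel_iff order_trans)
  then have "1 / 3 \<le> 2 * exp (- x)" by (simp add: exp_minus field_simps)
  then have "x^3 * (1 / 3) \<le> x^3 * (2 * exp (- x))" using \<open>0 < x\<close> by (intro mult_left_mono) auto
  then show ?thesis by simp
next
  case False
  \<comment> \<open>The second factor is the quotient of 2 x^3 - x^2 - 2 x - 2 by x - 8/5; the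
    remainder 304/125 - 2 is positive.\<close>
  then have "0 \<le> (x - 8/5) * (2 * x\<^sup>2 + 11/5 * x + 38/25)"
    by (intro mult_nonneg_nonneg add_nonneg_nonneg) auto
  also have "\<dots> = 2 * x^3 - x\<^sup>2 - 2 * x - 304/125"
    by (simp add: field_simps power2_eq_square power3_eq_cube)
  finally have "x\<^sup>2 + 2 * x + 2 \<le> 2 * x^3" by simp
  then have "(x\<^sup>2 + 2 * x + 2) * exp (- x) \<le> 2 * x^3 * exp (- x)" by (intro mult_right_mono) auto
  then show ?thesis by simp
qed

text \<open>With c = \<open>P T\<close>, the equation says that x exp(-x) g has derivative (h - c)
  exp(-x). So g is the integral H of the latter from 0, divided by x exp(-x). As \<open>h\<close>
  vanishes beyond \<open>T\<close>, \<open>P T\<close> is the integral of h exp(-x) over the whole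
  half line, and H therefore vanishes at infinity too.\<close>

lemma exponential_stein_solution:
  fixes h h' h'' :: "real \<Rightarrow> real" and T K1 K2 :: real
  assumes h: "\<And>x. (h has_real_derivative h' x) (at x)"
    and h': "\<And>x. (h' has_real_derivative h'' x) (at x)"
    and h'_bounds: "\<And>x. - K1 \<le> h' x" "\<And>x. h' x \<le> 0"
    and h''_bound: "\<And>x. \<bar>h'' x\<bar> \<le> K2"
    and T: "0 \<le> T" "\<And>x. T \<le> x \<Longrightarrow> h x = 0"
    and P: "\<And>x. (P has_real_derivative h x * exp (- x)) (at x)" "P 0 = 0"
  obtains g g' g'' where
      "g \<in> borel_measurable borel" "g' \<in> borel_measurable borel"
      "\<And>x. 0 < x \<Longrightarrow> (g has_real_derivative g' x) (at x)"
      "\<And>x. 0 < x \<Longrightarrow> (g' has_real_derivative g'' x) (at x)"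
      "\<And>x. 0 < x \<Longrightarrow> x * g' x - (x - 1) * g x = h x - P T"
      "\<And>x. 0 < x \<Longrightarrow> \<bar>g x\<bar> \<le> K1"
      "\<And>x. 0 < x \<Longrightarrow> \<bar>g' x\<bar> \<le> 2 * K1"
      "\<And>x. 0 < x \<Longrightarrow> \<bar>g'' x\<bar> \<le> 2 * (K2 + 4 * K1)"
proof -
  \<comment> \<open>\<open>c\<close> is the mean of \<open>h\<close> under the exponential law, \<open>A = x\<^sup>2 exp (-x) g'\<close> and \<open>B = x\<^sup>3 exp (-x) g''\<close>.
    Both vanish at \<open>0\<close> and at \<open>\<infinity>\<close>, so that bounds on \<open>A'\<close> and \<open>B'\<close> can be integrated from either end.\<close>
  define c where "c = P T"
  define H where "H x = P x - c * (1 - exp (- x))" for x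
  define A where "A x = (x - 1) * H x + x * exp (- x) * (h x - c)" for x
  define A' where "A' x = x * exp (- x) * h' x + H x" for x
  define B where "B x = x * A' x + (x - 2) * A x" for x
  define B' where "B' x = x\<^sup>2 * exp (- x) * h'' x + 2 * A x" for x
  define g where "g x = H x / (x * exp (- x))" for x
  define g' where "g' x = A x / (x\<^sup>2 * exp (- x))" for x
  define g'' where "g'' x = B x / (x^3 * exp (- x))" for x
  have K1: "0 \<le> K1" using h'_bounds[of 0] by linarith
  have K2: "0 \<le> K2" using h''_bound[of 0] by linarith
  have H: "(H has_real_derivative (h x - c) * exp (- x)) (at x)" for x
    unfolding H_def by (auto intro!: derivative_eq_intros P simp: algebra_simps)
  \<comment> \<open>The terms in h - c cancel in the derivative of \<open>A\<close> and recombine to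
    a second \<open>A\<close> in that of \<open>B\<close>. Hence \<open>A'\<close> is governed by
    \<open>h'\<close> and \<open>H\<close>, and \<open>B'\<close> by \<open>h''\<close> and
    \<open>A\<close>, and the bounds can be obtained one after the other.\<close>
  have A: "(A has_real_derivative A' x) (at x)" for x
    unfolding A_def A'_def by (auto intro!: derivative_eq_intros H h simp: algebra_simps)
  have A': "(A' has_real_derivative (1 - x) * exp (- x) * h' x + x * exp (- x) * h'' x + (h x - c) * exp (- x)) (at x)" for x
    unfolding A'_def by (auto intro!: derivative_eq_intros H h' simp: algebra_simps)
  have B: "(B has_real_derivative B' x) (at x)" for x
    unfolding B_def
    by (rule derivative_eq_intros A A' refl)+
      (simp add: B'_def A'_def A_def algebra_simps power2_eq_square)
  have lim0: "(F \<longlongrightarrow> 0) (at_right 0)" if "\<And>x. (F has_real_derivative F' x) (at x)" "F 0 = 0" for F F' :: "real \<Rightarrow> real"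
    using DERIV_isCont[OF that(1)[of 0]] that(2) by (auto simp: isCont_def intro: tendsto_within_subset)
  \<comment> \<open>Beyond \<open>T\<close> the function \<open>P\<close> is constant, so
    \<open>H\<close>, \<open>A\<close> and \<open>B\<close> are explicit multiples of exp(-x) and
    their limits at infinity are immediate.\<close>
  have P_tail: "P x = c" if "T \<le> x" for x
  proof -
    have P0: "(P has_real_derivative 0) (at u)" if "T \<le> u" for u
      using P(1)[of u] T(2)[OF that] by simp
    show ?thesis unfolding c_def
    proof (rule antisym)
      show "P x \<le> P T"
        by (rule DERIV_nonpos_imp_nonincreasing[OF \<open>T \<le> x\<close>]) (use P0 in blast)
      show "P T \<le> P x"
        by (rule DERIV_nonneg_imp_nondecreasing[OF \<open>T \<le> x\<close>]) (use P0 in blast)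
    qed
  qed
  have H_tail: "H x = c * exp (- x)" if "T \<le> x" for x
    using P_tail[OF that] by (simp add: H_def algebra_simps)
  have h'_tail: "h' x = 0" if "T < x" for x
  proof -
    have "\<forall>\<^sub>F y in nhds x. h y = 0"
      using that T(2) by (intro eventually_nhds_in_open[of "{T<..}", THEN eventually_mono]) auto
    then have "(h has_real_derivative 0) (at x)"
      by (subst DERIV_cong_ev[OF refl _ refl]) auto
    with h show ?thesis by (rule DERIV_unique)
  qed
  have A_tail: "A x = - c * exp (- x)" if "T \<le> x" for x
    using that by (simp add: A_def H_tail T(2) algebra_simps)
  have B_tail: "B x = 2 * c * exp (- x)" if "T < x" for x
    using that by (simp add: B_def A'_def A_tail H_tail h'_tail algebra_simps)
  have H_top: "(H \<longlongrightarrow> 0) at_top"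
  proof (rule Lim_transform_eventually)
    show "((\<lambda>x. c * exp (- x)) \<longlongrightarrow> 0) at_top" by real_asymp
    show "\<forall>\<^sub>F x in at_top. c * exp (- x) = H x"
      using eventually_ge_at_top[of T] by eventually_elim (simp add: H_tail)
  qed
  have A_top: "(A \<longlongrightarrow> 0) at_top"
  proof (rule Lim_transform_eventually)
    show "((\<lambda>x. - c * exp (- x)) \<longlongrightarrow> 0) at_top" by real_asymp
    show "\<forall>\<^sub>F x in at_top. - c * exp (- x) = A x"
      using eventually_ge_at_top[of T] by eventually_elim (simp add: A_tail)
  qed
  have B_top: "(B \<longlongrightarrow> 0) at_top"
  proof (rule Lim_transform_eventually)
    show "((\<lambda>x. 2 * c * exp (- x)) \<longlongrightarrow> 0) at_top" by real_asymp
    show "\<forall>\<^sub>F x in at_top. 2 * c * exp (- x) = B x"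
      using eventually_gt_at_top[of T] by eventually_elim (simp add: B_tail)
  qed
  have H0: "H 0 = 0" and A0: "A 0 = 0" and B0: "B 0 = 0"
    by (simp_all add: H_def A_def B_def P(2))

  have mono: "h y \<le> h x" if "x \<le> y" for x y
  proof (rule DERIV_nonpos_imp_nonincreasing[of x y h])
    show "\<exists>D. (h has_real_derivative D) (at u) \<and> D \<le> 0" for u
      using h h'_bounds(2) by blast
  qed (use that in simp)
  have lip: "h x + K1 * x \<le> h y + K1 * y" if "x \<le> y" for x y
  proof (rule DERIV_nonneg_imp_nondecreasing[where f = "\<lambda>x. h x + K1 * x"])
    fix u
    have "((\<lambda>x. h x + K1 * x) has_real_derivative h' u + K1) (at u)"
      by (auto intro!: derivative_eq_intros h)
    then show "\<exists>D. ((\<lambda>x. h x + K1 * x) has_real_derivative D) (at u) \<and> 0 \<le> D"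
      using h'_bounds(1)[of u] by (intro exI[of _ "h' u + K1"]) simp
  qed (use that in simp)
  \<comment> \<open>As \<open>h\<close> decreases, replacing \<open>h u\<close> by
    \<open>h x\<close> gives two lower bounds for \<open>H x\<close>: one by integrating over (0,
    x), one over (x, infinity). The convex combination with weights exp(-x) and 1 - exp(-x)
    eliminates the unknown d = h x - c.\<close>
  have H_nonneg: "0 \<le> H x" if "0 < x" for x
  proof -
    define d where "d = h x - c"
    have "0 \<le> H x - d * (1 - exp (- x))"
    proof -
      have "H 0 - d * (1 - exp (- 0)) \<le> H x - d * (1 - exp (- x))"
      proof (rule DERIV_nonneg_imp_nondecreasing[where f = "\<lambda>u. H u - d * (1 - exp (- u))"])
        fix u assume "u \<le> x"
        then have "0 \<le> (h u - h x) * exp (- u)" using mono[of u x] by simp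
        moreover have "((\<lambda>u. H u - d * (1 - exp (- u))) has_real_derivative (h u - h x) * exp (- u)) (at u)"
          by (auto intro!: derivative_eq_intros H simp: d_def algebra_simps)
        ultimately show "\<exists>D. ((\<lambda>u. H u - d * (1 - exp (- u))) has_real_derivative D) (at u) \<and> 0 \<le> D"
          by blast
      qed (use that in simp)
      then show ?thesis using H0 by simp
    qed
    moreover have "0 \<le> H x + d * exp (- x)"
    proof (rule nonneg_of_deriv_at_top[where f = "\<lambda>u. H u + d * exp (- u)" and f' = "\<lambda>u. (h u - h x) * exp (- u)"])
      have "((\<lambda>u. d * exp (- u)) \<longlongrightarrow> 0) at_top" by real_asymp
      from tendsto_add[OF H_top this] show "((\<lambda>u. H u + d * exp (- u)) \<longlongrightarrow> 0) at_top" by simp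
      show "((\<lambda>u. H u + d * exp (- u)) has_real_derivative (h u - h x) * exp (- u)) (at u)" for u
        by (auto intro!: derivative_eq_intros H simp: d_def algebra_simps)
    qed (use mono in \<open>simp add: mult_le_0_iff\<close>)
    ultimately have "0 \<le> exp (- x) * (H x - d * (1 - exp (- x))) + (1 - exp (- x)) * (H x + d * exp (- x))"
      using that by (intro add_nonneg_nonneg[OF mult_nonneg_nonneg mult_nonneg_nonneg]) simp_all
    then show ?thesis by (simp add: algebra_simps)
  qed
  \<comment> \<open>The same argument with \<open>h u\<close> compared to h x + K1 (x - u), which is
    legitimate because h + K1 x increases. Here (u - x + 1) exp(-u) is an antiderivative of (x - u)
    exp(-u). The same weights eliminate \<open>d\<close> and leave K1 x exp(-x).\<close>
  have H_le: "H x \<le> K1 * (x * exp (- x))" if "0 < x" for x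
  proof -
    define d where "d = h x - c"
    let ?f = "\<lambda>u. d * (1 - exp (- u)) + K1 * ((u - x + 1) * exp (- u) + x - 1) - H u"
    let ?g = "\<lambda>u. - d * exp (- u) + K1 * ((u - x + 1) * exp (- u)) - H u"
    have "0 \<le> ?f x"
    proof -
      have "?f 0 \<le> ?f x"
      proof (rule DERIV_nonneg_imp_nondecreasing[where f = ?f])
        fix u assume "u \<le> x"
        then have "0 \<le> (h x + K1 * x - (h u + K1 * u)) * exp (- u)" using lip[of u x] by simp
        moreover have "(?f has_real_derivative (h x + K1 * x - (h u + K1 * u)) * exp (- u)) (at u)"
          by (auto intro!: derivative_eq_intros H simp: d_def algebra_simps)
        ultimately show "\<exists>D. (?f has_real_derivative D) (at u) \<and> 0 \<le> D"
          by blast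
      qed (use that in simp)
      then show ?thesis using H0 by simp
    qed
    moreover have "0 \<le> ?g x"
    proof (rule nonneg_of_deriv_at_top[where f = ?g and f' = "\<lambda>u. (h x + K1 * x - (h u + K1 * u)) * exp (- u)"])
      have "((\<lambda>u. - d * exp (- u) + K1 * ((u - x + 1) * exp (- u))) \<longlongrightarrow> 0) at_top" by real_asymp
      from tendsto_diff[OF this H_top] show "(?g \<longlongrightarrow> 0) at_top" by simp
      show "(?g has_real_derivative (h x + K1 * x - (h u + K1 * u)) * exp (- u)) (at u)" for u
        by (auto intro!: derivative_eq_intros H simp: d_def algebra_simps)
    qed (use lip in \<open>simp add: mult_le_0_iff\<close>)
    ultimately have "0 \<le> exp (- x) * ?f x + (1 - exp (- x)) * ?g x"
      using that by (intro add_nonneg_nonneg[OF mult_nonneg_nonneg mult_nonneg_nonneg]) simp_all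
    then show ?thesis by (simp add: algebra_simps)
  qed

  \<comment> \<open>The two summands of \<open>A'\<close> have opposite signs and each is at most K1
    x exp(-x) in size, so no factor 2 is lost.\<close>
  have A'_bound: "\<bar>A' x\<bar> \<le> K1 * (x * exp (- x))" if "0 < x" for x
  proof -
    have "x * exp (- x) * (- K1) \<le> x * exp (- x) * h' x"
      "x * exp (- x) * h' x \<le> x * exp (- x) * 0"
      using that h'_bounds by (intro mult_left_mono; simp)+
    then show ?thesis
      using H_nonneg[OF that] H_le[OF that] unfolding A'_def by (simp add: abs_le_iff algebra_simps)
  qed
  have A_bound: "\<bar>A x\<bar> \<le> 2 * K1 * (x\<^sup>2 * exp (- x))" if "0 < x" for x
  proof -
    have "\<bar>A x\<bar> \<le> K1 * (x\<^sup>2 / 2)"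
    proof (rule abs_le_of_deriv_at_right[OF lim0[OF A A0] _ A _ _ \<open>0 < x\<close>, where g = "\<lambda>x. K1 * (x\<^sup>2 / 2)" and g' = "\<lambda>x. K1 * x"])
      show "((\<lambda>x. K1 * (x\<^sup>2 / 2)) \<longlongrightarrow> 0) (at_right 0)" by (auto intro!: tendsto_eq_intros)
      show "((\<lambda>x. K1 * (x\<^sup>2 / 2)) has_real_derivative K1 * y) (at y)" for y
        by (auto intro!: derivative_eq_intros)
      show "\<bar>A' y\<bar> \<le> K1 * y" if "0 < y" for y
        using K1 that by (intro order_trans[OF A'_bound] mult_left_mono) auto
    qed
    moreover have "\<bar>A x\<bar> \<le> K1 * ((1 + x) * exp (- x))"
    proof (rule abs_le_of_deriv_at_top[OF A_top _ A _ _ \<open>0 < x\<close>, where g = "\<lambda>x. K1 * ((1 + x) * exp (- x))" and g' = "\<lambda>x. K1 * (x * exp (- x))"])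
      show "((\<lambda>x. K1 * ((1 + x) * exp (- x))) \<longlongrightarrow> 0) at_top" by real_asymp
      show "((\<lambda>x. K1 * ((1 + x) * exp (- x))) has_real_derivative - (K1 * (y * exp (- y)))) (at y)" for y
        by (auto intro!: derivative_eq_intros simp: algebra_simps)
    qed (use A'_bound in simp)
    ultimately have "\<bar>A x\<bar> \<le> K1 * (2 * (x\<^sup>2 * exp (- x)))"
      using mult_left_mono[OF _ K1] quadratic_weight_disj[OF \<open>0 < x\<close>] order_trans by blast
    then show ?thesis by simp
  qed
  have B'_bound: "\<bar>B' x\<bar> \<le> (K2 + 4 * K1) * (x\<^sup>2 * exp (- x))" if "0 < x" for x
  proof -
    define w where "w = x\<^sup>2 * exp (- x)"
    have "\<bar>w * h'' x\<bar> \<le> K2 * w"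
      using h''_bound[of x] by (simp add: w_def abs_mult mult.commute mult_right_mono)
    then have "\<bar>w * h'' x + 2 * A x\<bar> \<le> K2 * w + 4 * (K1 * w)"
      using A_bound[OF that, folded w_def] by linarith
    then show ?thesis
      by (simp add: B'_def w_def algebra_simps)
  qed
  define L where "L = K2 + 4 * K1"
  have L: "0 \<le> L" using K1 K2 by (simp add: L_def)
  have B_bound: "\<bar>B x\<bar> \<le> 2 * L * (x^3 * exp (- x))" if "0 < x" for x
  proof -
    have "\<bar>B x\<bar> \<le> L * (x^3 / 3)"
    proof (rule abs_le_of_deriv_at_right[OF lim0[OF B B0] _ B _ _ \<open>0 < x\<close>, where g = "\<lambda>x. L * (x^3 / 3)" and g' = "\<lambda>x. L * x\<^sup>2"])
      show "((\<lambda>x. L * (x^3 / 3)) \<longlongrightarrow> 0) (at_right 0)" by (auto intro!: tendsto_eq_intros)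
      show "((\<lambda>x. L * (x^3 / 3)) has_real_derivative L * y\<^sup>2) (at y)" for y
        by (auto intro!: derivative_eq_intros)
      show "\<bar>B' y\<bar> \<le> L * y\<^sup>2" if "0 < y" for y
        using L that by (intro order_trans[OF B'_bound[folded L_def]] mult_left_mono) auto
    qed
    moreover have "\<bar>B x\<bar> \<le> L * ((x\<^sup>2 + 2 * x + 2) * exp (- x))"
    proof (rule abs_le_of_deriv_at_top[OF B_top _ B _ _ \<open>0 < x\<close>, where g = "\<lambda>x. L * ((x\<^sup>2 + 2 * x + 2) * exp (- x))" and g' = "\<lambda>x. L * (x\<^sup>2 * exp (- x))"])
      show "((\<lambda>x. L * ((x\<^sup>2 + 2 * x + 2) * exp (- x))) \<longlongrightarrow> 0) at_top" by real_asymp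
      show "((\<lambda>x. L * ((x\<^sup>2 + 2 * x + 2) * exp (- x))) has_real_derivative - (L * (y\<^sup>2 * exp (- y)))) (at y)" for y
        by (auto intro!: derivative_eq_intros simp: algebra_simps)
    qed (use B'_bound in \<open>simp add: L_def\<close>)
    ultimately have "\<bar>B x\<bar> \<le> L * (2 * (x^3 * exp (- x)))"
      using mult_left_mono[OF _ L] cubic_weight_disj[OF \<open>0 < x\<close>] order_trans by blast
    then show ?thesis by simp
  qed

  show thesis
  proof
    have [measurable]: "H \<in> borel_measurable borel" "A \<in> borel_measurable borel"
      using H A by (auto intro!: borel_measurable_continuous_onI DERIV_isCont simp: continuous_on_eq_continuous_at)
    show "g \<in> borel_measurable borel" "g' \<in> borel_measurable borel"
      unfolding g_def g'_def by measurable
    show "(g has_real_derivative g' x) (at x)" if "0 < x" for x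
      unfolding g_def using that
      by (auto intro!: derivative_eq_intros H simp: g'_def A_def field_simps power2_eq_square)
    show "(g' has_real_derivative g'' x) (at x)" if "0 < x" for x
      unfolding g'_def using that
      by (auto intro!: derivative_eq_intros A simp: g''_def B_def field_simps power2_eq_square power3_eq_cube)
    show "x * g' x - (x - 1) * g x = h x - P T" if "0 < x" for x
      using that by (simp add: g'_def g_def A_def c_def[symmetric] field_simps power2_eq_square)
    show "\<bar>g x\<bar> \<le> K1" if "0 < x" for x
      using H_nonneg[OF that] H_le[OF that] that by (simp add: g_def abs_of_nonneg divide_le_eq)
    show "\<bar>g' x\<bar> \<le> 2 * K1" if "0 < x" for x
      using that A_bound by (simp add: g'_def abs_divide divide_le_eq)
    show "\<bar>g'' x\<bar> \<le> 2 * (K2 + 4 * K1)" if "0 < x" for x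
      using that B_bound by (simp add: g''_def abs_divide divide_le_eq L_def)
  qed
qed

subsection \<open>Smoothed indicators\<close>

text \<open>The profile f(y) = 1 - y + sin(2 pi y)/(2 pi) has f' = cos(2 pi y) - 1 in [-2, 0] and
  |f''| <= 2 pi. Both derivatives vanish at 0 and 1, so clamping and rescaling by
  \<open>\<delta>\<close> keeps two derivatives. Its area over [0, 1] is 1/2, which gives the terms
  \<delta>/2.\<close>

lemma smooth_step:
  fixes s \<delta> :: real
  assumes "0 < \<delta>"
  obtains h h' h'' P :: "real \<Rightarrow> real" where
    "\<And>x. (h has_real_derivative h' x) (at x)"
    "\<And>x. (h' has_real_derivative h'' x) (at x)"
    "\<And>x. - (2 / \<delta>) \<le> h' x" "\<And>x. h' x \<le> 0"
    "\<And>x. \<bar>h'' x\<bar> \<le> 2 * pi / \<delta>\<^sup>2"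
    "\<And>x. x \<le> s \<Longrightarrow> h x = 1" "\<And>x. s + \<delta> \<le> x \<Longrightarrow> h x = 0"
    "\<And>x. 0 \<le> h x" "\<And>x. h x \<le> 1"
    "\<And>x. (P has_real_derivative h x * exp (- x)) (at x)" "P 0 = 0"
    "0 \<le> s \<Longrightarrow> P (s + \<delta>) \<le> 1 - exp (- s) + \<delta> / 2"
    "0 \<le> s + \<delta> \<Longrightarrow> 1 - exp (- (s + \<delta>)) - \<delta> / 2 \<le> P (s + \<delta>)"
proof -
  define f where "f y = 1 - y + sin (2 * pi * y) / (2 * pi)" for y :: real
  define f' where "f' y = cos (2 * pi * y) - 1" for y :: real
  define f'' where "f'' y = - 2 * pi * sin (2 * pi * y)" for y :: real
  define y where "y x = (x - s) / \<delta>" for x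
  define h where "h x = f (max 0 (min 1 (y x)))" for x
  define h' where "h' x = f' (max 0 (min 1 (y x))) / \<delta>" for x
  define h'' where "h'' x = f'' (max 0 (min 1 (y x))) / \<delta>\<^sup>2" for x
  \<comment> \<open>\<open>Q\<close> is an antiderivative of \<open>h\<close> on the interval of
    descent, without the weight exp(-x).\<close>
  define Q where "Q x = \<delta> * (y x - (y x)\<^sup>2 / 2 - cos (2 * pi * y x) / (4 * pi\<^sup>2))" for x
  have y: "(y has_real_derivative 1 / \<delta>) (at x)" for x
    unfolding y_def using assms by (auto intro!: derivative_eq_intros)
  have f: "(f has_real_derivative f' z) (at z)" for z
    unfolding f_def f'_def by (auto intro!: derivative_eq_intros)
  have f': "(f' has_real_derivative f'' z) (at z)" for z
    unfolding f'_def f''_def by (auto intro!: derivative_eq_intros)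
  have h: "(h has_real_derivative h' x) (at x)" for x
    using DERIV_chain2[OF DERIV_clamp[OF f] y, of x] by (simp add: h_def[abs_def] h'_def f'_def)
  have h': "(h' has_real_derivative h'' x) (at x)" for x
    using DERIV_cdivide[OF DERIV_chain2[OF DERIV_clamp[OF f'] y, of x], of \<delta>]
    by (simp add: h'_def[abs_def] h''_def f''_def power2_eq_square)
  have h'_bounds: "- (2 / \<delta>) \<le> h' x" "h' x \<le> 0" for x
    using assms cos_ge_minus_one[of "2 * pi * max 0 (min 1 (y x))"]
      cos_le_one[of "2 * pi * max 0 (min 1 (y x))"]
    by (auto simp: h'_def f'_def field_simps)
  have h''_bound: "\<bar>h'' x\<bar> \<le> 2 * pi / \<delta>\<^sup>2" for x
    using abs_sin_le_one[of "2 * pi * max 0 (min 1 (y x))"]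
    by (auto simp: h''_def f''_def abs_mult abs_divide intro!: divide_right_mono)
  have h1: "h x = 1" if "x \<le> s" for x
  proof -
    have "y x \<le> 0" using that assms by (simp add: y_def divide_le_0_iff)
    then show ?thesis by (simp add: h_def f_def)
  qed
  have h0: "h x = 0" if "s + \<delta> \<le> x" for x
  proof -
    have "1 \<le> y x" using that assms by (simp add: y_def)
    then show ?thesis by (simp add: h_def f_def)
  qed
  have mono: "h v \<le> h u" if "u \<le> v" for u v
  proof (rule DERIV_nonpos_imp_nonincreasing[of u v h])
    show "\<exists>D. (h has_real_derivative D) (at z) \<and> D \<le> 0" for z
      using h h'_bounds(2) by blast
  qed (use that in simp)
  have h_nonneg: "0 \<le> h x" for x
    using mono[of x "max x (s + \<delta>)"] h0[of "max x (s + \<delta>)"] by simp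
  have h_le1: "h x \<le> 1" for x
    using mono[of "min x s" x] h1[of "min x s"] by simp
  have Q: "(Q has_real_derivative h x) (at x)" if "s \<le> x" "x \<le> s + \<delta>" for x
  proof -
    have "max 0 (min 1 (y x)) = y x" using that assms by (simp add: y_def)
    then show ?thesis
      unfolding Q_def h_def using assms
      by (auto intro!: derivative_eq_intros y simp: f_def field_simps power2_eq_square)
  qed
  have Q_diff: "Q (s + \<delta>) - Q s = \<delta> / 2"
    using assms by (simp add: Q_def y_def field_simps)
  have "isCont h x" for x using h by (rule DERIV_isCont)
  then obtain P where P: "\<And>x. (P has_real_derivative h x * exp (- x)) (at x)" "P 0 = 0"
    using continuous_antiderivative[of "-\<infinity>" "\<lambda>x. h x * exp (- x)" 0] by auto
  have P_eq: "P x = 1 - exp (- x)" if "0 \<le> x" "x \<le> s" for x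
  proof -
    have D: "((\<lambda>x. P x - (1 - exp (- x))) has_real_derivative 0) (at u)" if "u \<le> s" for u
      using h1[OF that] by (auto intro!: derivative_eq_intros P)
    have "P x - (1 - exp (- x)) \<le> P 0 - (1 - exp (- 0))"
      by (rule DERIV_nonpos_imp_nonincreasing[of 0 x "\<lambda>x. P x - (1 - exp (- x))"])
        (use D that in \<open>auto intro!: exI[of _ 0]\<close>)
    moreover have "P 0 - (1 - exp (- 0)) \<le> P x - (1 - exp (- x))"
      by (rule DERIV_nonneg_imp_nondecreasing[of 0 x "\<lambda>x. P x - (1 - exp (- x))"])
        (use D that in \<open>auto intro!: exI[of _ 0]\<close>)
    ultimately show ?thesis using P(2) by simp
  qed
  have "P (s + \<delta>) \<le> 1 - exp (- s) + \<delta> / 2" if "0 \<le> s"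
  proof -
    \<comment> \<open>To the right of 0 the weight exp(-x) is at most 1, so \<open>P\<close> grows
      over the descent by no more than \<open>Q\<close>, that is, by at most \<delta>/2.\<close>
    have "Q s - P s \<le> Q (s + \<delta>) - P (s + \<delta>)"
    proof (rule DERIV_nonneg_imp_nondecreasing[of _ _ "\<lambda>x. Q x - P x"])
      fix x assume x: "s \<le> x" "x \<le> s + \<delta>"
      have "((\<lambda>x. Q x - P x) has_real_derivative h x * (1 - exp (- x))) (at x)"
        by (auto intro!: derivative_eq_intros Q P x simp: algebra_simps)
      moreover have "0 \<le> h x * (1 - exp (- x))"
        using h_nonneg x that by (intro mult_nonneg_nonneg) auto
      ultimately show "\<exists>D. ((\<lambda>x. Q x - P x) has_real_derivative D) (at x) \<and> 0 \<le> D" by blast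
    qed (use assms in simp)
    then show ?thesis using P_eq[of s] Q_diff that by simp
  qed
  moreover have "1 - exp (- (s + \<delta>)) - \<delta> / 2 \<le> P (s + \<delta>)" if "0 \<le> s + \<delta>"
  proof -
    \<comment> \<open>Here the missing mass 1 - h is estimated, whose unweighted integral over the
      descent is \<delta>/2. The descent may start below 0, where exp(-x) exceeds 1, so the weighted
      comparison begins at \<open>l\<close>; discarding [s, l] only loses a nonnegative
      amount.\<close>
    define l where "l = max 0 s"
    have l: "s \<le> l" "l \<le> s + \<delta>" "0 \<le> l" using that assms by (auto simp: l_def)
    have "P l = 1 - exp (- l)" using P_eq[of l] P(2) by (cases "0 \<le> s") (auto simp: l_def)
    moreover have "s - Q s \<le> l - Q l"
    proof (rule DERIV_nonneg_imp_nondecreasing[of _ _ "\<lambda>x. x - Q x"])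
      fix x assume x: "s \<le> x" "x \<le> l"
      have "((\<lambda>x. x - Q x) has_real_derivative 1 - h x) (at x)"
        using x l by (auto intro!: derivative_eq_intros Q)
      moreover have "0 \<le> 1 - h x" using h_le1 by simp
      ultimately show "\<exists>D. ((\<lambda>x. x - Q x) has_real_derivative D) (at x) \<and> 0 \<le> D" by blast
    qed (use l in simp)
    moreover have "(l - Q l) - (1 - exp (- l) - P l)
        \<le> (s + \<delta> - Q (s + \<delta>)) - (1 - exp (- (s + \<delta>)) - P (s + \<delta>))"
    proof (rule DERIV_nonneg_imp_nondecreasing[of _ _ "\<lambda>x. (x - Q x) - (1 - exp (- x) - P x)"])
      fix x assume x: "l \<le> x" "x \<le> s + \<delta>"
      have "((\<lambda>x. (x - Q x) - (1 - exp (- x) - P x)) has_real_derivative (1 - h x) * (1 - exp (- x))) (at x)"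
        using x l by (auto intro!: derivative_eq_intros Q P simp: algebra_simps)
      moreover have "0 \<le> (1 - h x) * (1 - exp (- x))"
        using h_le1 x l by (intro mult_nonneg_nonneg) auto
      ultimately show "\<exists>D. ((\<lambda>x. (x - Q x) - (1 - exp (- x) - P x)) has_real_derivative D) (at x) \<and> 0 \<le> D"
        by blast
    qed (use l in simp)
    ultimately show ?thesis using Q_diff by linarith
  qed
  ultimately show thesis
    using that[OF h h' h'_bounds h''_bound h1 h0 h_nonneg h_le1 P] by blast
qed

subsection \<open>Exchangeable pairs\<close>

lemma Taylor_cubic_remainder:
  fixes G g g' g'' :: "real \<Rightarrow> real"
  assumes "\<And>x. 0 < x \<Longrightarrow> (G has_real_derivative g x) (at x)"
    and "\<And>x. 0 < x \<Longrightarrow> (g has_real_derivative g' x) (at x)"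
    and "\<And>x. 0 < x \<Longrightarrow> (g' has_real_derivative g'' x) (at x)"
    and "\<And>x. 0 < x \<Longrightarrow> \<bar>g'' x\<bar> \<le> B"
    and "0 < x" "0 < y"
  shows "\<bar>G y - G x - (g x * (y - x) + g' x * (y - x)\<^sup>2 / 2)\<bar> \<le> B / 6 * \<bar>y - x\<bar>^3"
proof (cases "y = x")
  case False
  define d where "d n = (if n = 0 then G else if n = 1 then g else if n = 2 then g' else g'')" for n :: nat
  have "\<forall>m t. m < 3 \<and> min x y \<le> t \<and> t \<le> max x y \<longrightarrow> DERIV (d m) t :> d (Suc m) t"
    using assms by (auto simp: d_def numeral_eq_Suc less_Suc_eq)
  then obtain t where t: "if y < x then y < t \<and> t < x else x < t \<and> t < y"
    and "G y = (\<Sum>m<3. d m x / fact m * (y - x)^m) + d 3 t / fact 3 * (y - x)^3"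
    using Taylor[of 3 d G "min x y" "max x y" x y] False by (auto simp: d_def)
  then have "G y - G x - (g x * (y - x) + g' x * (y - x)\<^sup>2 / 2) = g'' t / 6 * (y - x)^3"
    by (simp add: d_def numeral_eq_Suc)
  moreover
  have "\<bar>g'' t\<bar> \<le> B" using t assms(4-6) by (auto split: if_splits)
  then have "\<bar>g'' t / 6 * (y - x)^3\<bar> \<le> B / 6 * \<bar>y - x\<bar>^3"
    by (simp add: abs_mult power_abs mult_right_mono)
  ultimately show ?thesis by (simp only:)
qed simp

lemma integrable_bounded_mult:
  fixes f u :: "'a \<Rightarrow> real"
  assumes "f \<in> borel_measurable M" "\<And>x. \<bar>f x\<bar> \<le> B" "integrable M u"
  shows "integrable M (\<lambda>x. f x * u x)"
proof (rule Bochner_Integration.integrable_bound)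
  show "integrable M (\<lambda>x. B * \<bar>u x\<bar>)" using assms(3) by simp
  have "\<bar>f x * u x\<bar> \<le> B * \<bar>u x\<bar>" for x
    using assms(2) by (simp add: abs_mult mult_right_mono)
  then show "AE x in M. norm (f x * u x) \<le> norm (B * \<bar>u x\<bar>)"
    by (intro AE_I2) (simp add: order_trans[OF _ abs_ge_self])
qed (use assms in simp)

lemma abs_integral_bounded_mult_le:
  fixes f u :: "'a \<Rightarrow> real"
  assumes "f \<in> borel_measurable M" "\<And>x. \<bar>f x\<bar> \<le> B" "integrable M u"
  shows "\<bar>\<integral>x. f x * u x \<partial>M\<bar> \<le> B * (\<integral>x. \<bar>u x\<bar> \<partial>M)"
proof -
  have "\<bar>\<integral>x. f x * u x \<partial>M\<bar> \<le> (\<integral>x. \<bar>f x * u x\<bar> \<partial>M)"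
    by (rule integral_abs_bound)
  also have "\<dots> \<le> (\<integral>x. B * \<bar>u x\<bar> \<partial>M)"
    using assms integrable_bounded_mult[OF assms]
    by (intro integral_mono integrable_abs) (auto simp: abs_mult mult_right_mono)
  finally show ?thesis by simp
qed

section \<open>The regression condition and its consequences for moments\<close>

locale exchangeable_regression = prob_space M
  for M :: "'a measure" +
  fixes F :: "'a measure" and W W' R :: "'a \<Rightarrow> real" and a :: real
  assumes W_nonneg: "AE x in M. 0 \<le> W x"
    and integrable_W2: "integrable M (\<lambda>x. (W x)\<^sup>2)"
    and exchangeable: "exchangeable_pair M W W'"
    and a_pos: "0 < a"
    and subalg: "subalgebra M F"
    and F_contains_W: "subalgebra F (vimage_algebra (space M) W borel)"
    and R_measurable [measurable]: "R \<in> borel_measurable M"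
    and regression: "AE x in M. real_cond_exp M F (\<lambda>y. W' y - W y) x = - a * (W x - 1) + R x"
begin

sublocale finite_measure_subalgebra M F
  by standard (rule subalg)

definition C :: "'a \<Rightarrow> real" where
  "C = real_cond_exp M F (\<lambda>y. (W' y - W y)\<^sup>2)"

lemma W_measurable [measurable]: "W \<in> borel_measurable M" "W' \<in> borel_measurable M"
  using exchangeable by (simp_all add: exchangeable_pair_def)

lemma W_measurable_F [measurable]: "W \<in> borel_measurable F"
  by (rule measurable_from_subalg[OF F_contains_W measurable_vimage_algebra1]) simp

text \<open>The first marginals of the two equal joint laws. This is what makes E (k(W') - k(W))
  vanish.\<close>

lemma distr_W': "distr M borel W' = distr M borel W"
proof -
  have "distr (distr M (borel \<Otimes>\<^sub>M borel) (\<lambda>x. (W x, W' x))) borel fst =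
      distr (distr M (borel \<Otimes>\<^sub>M borel) (\<lambda>x. (W' x, W x))) borel fst"
    using exchangeable by (simp add: exchangeable_pair_def)
  then show ?thesis by (simp add: distr_distr comp_def)
qed

lemma expectation_W':
  assumes [measurable]: "k \<in> borel_measurable borel"
  shows "expectation (\<lambda>x. k (W' x)) = (expectation (\<lambda>x. k (W x)) :: real)"
  using integral_distr[of W' M borel k] integral_distr[of W M borel k] by (simp add: distr_W')

lemma integrable_W'_iff:
  fixes k :: "real \<Rightarrow> real"
  assumes [measurable]: "k \<in> borel_measurable borel"
  shows "integrable M (\<lambda>x. k (W' x)) \<longleftrightarrow> integrable M (\<lambda>x. k (W x))"
  using integrable_distr_eq[of W' M borel k] integrable_distr_eq[of W M borel k] by (simp add: distr_W')

lemma integrable_W: "integrable M W"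
  by (rule square_integrable_imp_integrable[OF _ integrable_W2]) simp

lemma integrable_W': "integrable M W'"
  using integrable_W'_iff[of "\<lambda>x. x"] integrable_W by simp

lemma integrable_increment_sq: "integrable M (\<lambda>x. (W' x - W x)\<^sup>2)"
proof (rule Bochner_Integration.integrable_bound)
  show "integrable M (\<lambda>x. 2 * (W' x)\<^sup>2 + 2 * (W x)\<^sup>2)"
    using integrable_W2 integrable_W'_iff[of "\<lambda>x. x\<^sup>2"] by simp
  have "(W' x - W x)\<^sup>2 \<le> 2 * (W' x)\<^sup>2 + 2 * (W x)\<^sup>2" for x
    using zero_le_power2[of "W' x + W x"] by (simp add: power2_eq_square algebra_simps)
  then show "AE x in M. norm ((W' x - W x)\<^sup>2) \<le> norm (2 * (W' x)\<^sup>2 + 2 * (W x)\<^sup>2)"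
    by (intro AE_I2) (auto intro: order_trans)
qed simp

lemma integrable_C: "integrable M C"
  unfolding C_def by (rule real_cond_exp_int(1)[OF integrable_increment_sq])

text \<open>The regression identity writes \<open>R\<close> almost everywhere as a sum of integrable
  variables.\<close>

lemma integrable_R: "integrable M R"
proof (rule integrable_cong_AE_imp)
  show "integrable M (\<lambda>x. real_cond_exp M F (\<lambda>y. W' y - W y) x + a * (W x - 1))"
    using integrable_W integrable_W' by (intro Bochner_Integration.integrable_add real_cond_exp_int(1)) auto
qed (use regression in auto)

text \<open>The Stein solution is controlled only on \<open>(0, \<infinity>)\<close>, while \<open>W\<close> may have an atom at \<open>0\<close>; hence the
  shift by \<open>\<epsilon>\<close>, which tends to \<open>0\<close> in the next lemma.\<close>

lemma stein_identity_bound: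
  fixes g g' g'' :: "real \<Rightarrow> real" and \<epsilon> :: real
  assumes [measurable]: "g \<in> borel_measurable borel" "g' \<in> borel_measurable borel"
    and g: "\<And>x. 0 < x \<Longrightarrow> (g has_real_derivative g' x) (at x)"
    and g': "\<And>x. 0 < x \<Longrightarrow> (g' has_real_derivative g'' x) (at x)"
    and g_bound: "\<And>x. 0 < x \<Longrightarrow> \<bar>g x\<bar> \<le> B1"
    and g'_bound: "\<And>x. 0 < x \<Longrightarrow> \<bar>g' x\<bar> \<le> B2"
    and g''_bound: "\<And>x. 0 < x \<Longrightarrow> \<bar>g'' x\<bar> \<le> B3"
    and "0 < \<epsilon>"
    and int3: "integrable M (\<lambda>x. \<bar>W' x - W x\<bar>^3)"
  shows "\<bar>expectation (\<lambda>x. W x * g' (\<epsilon> + \<bar>W x\<bar>) - (W x - 1) * g (\<epsilon> + \<bar>W x\<bar>))\<bar>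
    \<le> B2 * expectation (\<lambda>x. \<bar>W x - C x / (2 * a)\<bar>)
      + (B1 * expectation (\<lambda>x. \<bar>R x\<bar>) + B3 / 6 * expectation (\<lambda>x. \<bar>W' x - W x\<bar>^3)) / a"
proof -
  \<comment> \<open>The absolute value makes the argument positive at every point, not just almost
    everywhere, so \<open>u\<close> and \<open>v\<close> are bounded everywhere; they are also
    measurable for \<open>F\<close>.\<close>
  define u where "u x = g (\<epsilon> + \<bar>W x\<bar>)" for x
  define v where "v x = g' (\<epsilon> + \<bar>W x\<bar>)" for x
  define D where "D x = W' x - W x" for x
  have pos: "0 < \<epsilon> + \<bar>z\<bar>" for z :: real using \<open>0 < \<epsilon>\<close> by simp
  have uF: "u \<in> borel_measurable F" and vF: "v \<in> borel_measurable F"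
    unfolding u_def v_def by measurable
  have [measurable]: "u \<in> borel_measurable M" "v \<in> borel_measurable M" "D \<in> borel_measurable M"
    unfolding u_def v_def D_def by measurable
  have u: "\<bar>u x\<bar> \<le> B1" and v: "\<bar>v x\<bar> \<le> B2" for x
    using g_bound[OF pos] g'_bound[OF pos] by (simp_all add: u_def v_def)
  have intD: "integrable M D"
    unfolding D_def using integrable_W integrable_W' by simp
  have intD2: "integrable M (\<lambda>x. (D x)\<^sup>2)"
    unfolding D_def by (rule integrable_increment_sq)
  have int3D: "integrable M (\<lambda>x. \<bar>D x\<bar>^3)"
    using int3 by (simp add: D_def)
  have intW1: "integrable M (\<lambda>x. W x - 1)" using integrable_W by simp
  have intWC: "integrable M (\<lambda>x. W x - C x / (2 * a))" using integrable_W integrable_C by simp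
  note int_u = integrable_bounded_mult[of u M B1, OF _ u] and int_v = integrable_bounded_mult[of v M B2, OF _ v]
  note int = int_u[OF _ intD] int_u[OF _ intW1] int_u[OF _ integrable_R] int_v[OF _ intD2]
    int_v[OF _ integrable_C] int_v[OF _ intWC]

  \<comment> \<open>Normalising G at \<epsilon> gives |k z| <= B1 |z|, which makes k(W)
    integrable.\<close>
  obtain G where G: "\<And>x. 0 < x \<Longrightarrow> (G has_real_derivative g x) (at x)" and "G \<epsilon> = 0"
    using continuous_antiderivative[of 0 g \<epsilon>] g[THEN DERIV_isCont] by (auto simp: zero_ereal_def)
  define k where "k z = G (\<epsilon> + \<bar>z\<bar>)" for z
  have "continuous_on UNIV k"
    unfolding k_def
  proof (rule continuous_on_compose2[of "{0<..}" G])
    show "continuous_on {0<..} G"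
      using G by (auto intro!: continuous_at_imp_continuous_on DERIV_isCont)
  qed (use pos in \<open>auto intro!: continuous_intros\<close>)
  then have k_measurable [measurable]: "k \<in> borel_measurable borel"
    by (rule borel_measurable_continuous_onI)
  have k_bound: "\<bar>k z\<bar> \<le> B1 * \<bar>z\<bar>" for z
  proof -
    have "norm (G (\<epsilon> + \<bar>z\<bar>) - G \<epsilon>) \<le> B1 * norm (\<epsilon> + \<bar>z\<bar> - \<epsilon>)"
      using \<open>0 < \<epsilon>\<close> g_bound
      by (intro field_differentiable_bound[of "{\<epsilon>..}" G g])
        (auto intro!: has_field_derivative_at_within[OF G])
    then show ?thesis using \<open>G \<epsilon> = 0\<close> by (simp add: k_def)
  qed
  have int_kW: "integrable M (\<lambda>x. k (W x))"
    by (rule Bochner_Integration.integrable_bound[of M "\<lambda>x. B1 * \<bar>W x\<bar>"])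
      (use integrable_W k_bound in \<open>auto intro: order_trans[OF _ abs_ge_self]\<close>)
  then have int_kW': "integrable M (\<lambda>x. k (W' x))"
    using integrable_W'_iff[of k] by simp

  \<comment> \<open>\<open>u\<close> can be taken inside the conditional expectation, so the
    increment may be replaced by its regression.\<close>
  have cond1: "(\<integral>x. u x * D x \<partial>M) = (\<integral>x. u x * R x \<partial>M) - a * (\<integral>x. u x * (W x - 1) \<partial>M)"
  proof -
    have "(\<integral>x. u x * D x \<partial>M) = (\<integral>x. u x * real_cond_exp M F D x \<partial>M)"
      using int uF by (intro real_cond_exp_intg(2)[symmetric]) auto
    also have "\<dots> = (\<integral>x. u x * R x - a * (u x * (W x - 1)) \<partial>M)"
    proof (rule integral_cong_AE)
      show "AE x in M. u x * real_cond_exp M F D x = u x * R x - a * (u x * (W x - 1))"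
        using regression
      proof eventually_elim
        case (elim x)
        then have "real_cond_exp M F D x = - a * (W x - 1) + R x" by (simp add: D_def[abs_def])
        then show ?case by (simp only:) (simp add: algebra_simps)
      qed
    qed auto
    also have "\<dots> = (\<integral>x. u x * R x \<partial>M) - a * (\<integral>x. u x * (W x - 1) \<partial>M)"
      using int by simp
    finally show ?thesis .
  qed
  have cond2: "(\<integral>x. v x * (D x)\<^sup>2 \<partial>M) = (\<integral>x. v x * C x \<partial>M)"
    using int vF unfolding C_def D_def[symmetric] by (intro real_cond_exp_intg(2)[symmetric]) auto
  have taylor: "\<bar>(\<integral>x. u x * D x \<partial>M) + (\<integral>x. v x * (D x)\<^sup>2 \<partial>M) / 2\<bar> \<le> B3 / 6 * (\<integral>x. \<bar>D x\<bar>^3 \<partial>M)"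
  proof -
    \<comment> \<open>\<open>?r\<close> is the cubic Taylor remainder. As k(W') and k(W) have equal
      means, its mean is minus that of the first and second order terms.\<close>
    let ?r = "\<lambda>x. k (W' x) - k (W x) - (u x * D x + v x * (D x)\<^sup>2 / 2)"
    have int_r: "integrable M ?r"
      using int int_kW int_kW' by simp
    have "(\<integral>x. ?r x \<partial>M) = - ((\<integral>x. u x * D x \<partial>M) + (\<integral>x. v x * (D x)\<^sup>2 \<partial>M) / 2)"
      using int int_kW int_kW' expectation_W'[of k] by simp
    then have "\<bar>(\<integral>x. u x * D x \<partial>M) + (\<integral>x. v x * (D x)\<^sup>2 \<partial>M) / 2\<bar> = \<bar>\<integral>x. ?r x \<partial>M\<bar>"
      by simp
    also have "\<dots> \<le> (\<integral>x. \<bar>?r x\<bar> \<partial>M)" by (rule integral_abs_bound)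
    also have "\<dots> \<le> (\<integral>x. B3 / 6 * \<bar>D x\<bar>^3 \<partial>M)"
    proof (rule integral_mono_AE)
      have "AE z in distr M borel W'. 0 \<le> z"
        unfolding distr_W' using W_nonneg by (subst AE_distr_iff) auto
      then have "AE x in M. 0 \<le> W' x"
        by (subst (asm) AE_distr_iff) auto
      with W_nonneg show "AE x in M. \<bar>?r x\<bar> \<le> B3 / 6 * \<bar>D x\<bar>^3"
      proof eventually_elim
        case (elim x)
        then show ?case
          using Taylor_cubic_remainder[OF G g g' g''_bound pos pos, of "W' x" "W x"]
          by (simp add: k_def u_def v_def D_def)
      qed
    qed (use int_r int3D in auto)
    finally show ?thesis by simp
  qed
  \<comment> \<open>Adding and subtracting v C / (2 a) isolates the first error term. The rest is
    then rewritten by the two conditioning identities, \<open>cond1\<close> solved for the integral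
    of u (W - 1).\<close>
  have "(\<integral>x. W x * v x - (W x - 1) * u x \<partial>M)
      = (\<integral>x. v x * (W x - C x / (2 * a)) + v x * C x / (2 * a) - u x * (W x - 1) \<partial>M)"
    by (simp add: algebra_simps)
  also have "\<dots> = (\<integral>x. v x * (W x - C x / (2 * a)) \<partial>M) + (\<integral>x. v x * C x \<partial>M) / (2 * a)
      - (\<integral>x. u x * (W x - 1) \<partial>M)"
    using int by simp
  also have "\<dots> = (\<integral>x. v x * (W x - C x / (2 * a)) \<partial>M)
      + (((\<integral>x. u x * D x \<partial>M) + (\<integral>x. v x * (D x)\<^sup>2 \<partial>M) / 2) - (\<integral>x. u x * R x \<partial>M)) / a"
  proof -
    have solve: "I = (J - K) / a" if "K = J - a * I" for I J K :: real
      using a_pos that by (simp add: field_simps)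
    show ?thesis
      unfolding solve[OF cond1] cond2 by (simp add: add_divide_distrib diff_divide_distrib)
  qed
  finally have eq: "(\<integral>x. W x * v x - (W x - 1) * u x \<partial>M) = (\<integral>x. v x * (W x - C x / (2 * a)) \<partial>M)
      + (((\<integral>x. u x * D x \<partial>M) + (\<integral>x. v x * (D x)\<^sup>2 \<partial>M) / 2) - (\<integral>x. u x * R x \<partial>M)) / a" .
  have "\<bar>((\<integral>x. u x * D x \<partial>M) + (\<integral>x. v x * (D x)\<^sup>2 \<partial>M) / 2) - (\<integral>x. u x * R x \<partial>M)\<bar>
      \<le> B1 * (\<integral>x. \<bar>R x\<bar> \<partial>M) + B3 / 6 * (\<integral>x. \<bar>D x\<bar>^3 \<partial>M)"
    using taylor abs_integral_bounded_mult_le[of u M B1, OF _ u integrable_R, simplified] by linarith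
  then have "\<bar>\<integral>x. W x * v x - (W x - 1) * u x \<partial>M\<bar> \<le> B2 * (\<integral>x. \<bar>W x - C x / (2 * a)\<bar> \<partial>M)
      + (B1 * (\<integral>x. \<bar>R x\<bar> \<partial>M) + B3 / 6 * (\<integral>x. \<bar>D x\<bar>^3 \<partial>M)) / a"
    unfolding eq using abs_integral_bounded_mult_le[of v M B2, OF _ v intWC] a_pos
    by (intro order_trans[OF abs_triangle_ineq] add_mono) (auto simp: abs_divide intro!: divide_right_mono)
  then show ?thesis by (simp add: u_def v_def D_def)
qed

text \<open>\<open>P T\<close> is the mean of \<open>h\<close> under the exponential law. The shift
  costs at most 4 K1 \<epsilon>: K1 \<epsilon> since \<open>h\<close> is Lipschitz, and 3 K1
  \<epsilon> from the changed coefficients of \<open>g\<close> and \<open>g'\<close>.\<close>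

lemma smooth_expectation_bound:
  fixes h h' h'' P :: "real \<Rightarrow> real"
  assumes h: "\<And>x. (h has_real_derivative h' x) (at x)"
    and h': "\<And>x. (h' has_real_derivative h'' x) (at x)"
    and h'_bounds: "\<And>x. - K1 \<le> h' x" "\<And>x. h' x \<le> 0"
    and h''_bound: "\<And>x. \<bar>h'' x\<bar> \<le> K2"
    and h_bounds: "\<And>x. 0 \<le> h x" "\<And>x. h x \<le> 1"
    and T: "0 \<le> T" "\<And>x. T \<le> x \<Longrightarrow> h x = 0"
    and P: "\<And>x. (P has_real_derivative h x * exp (- x)) (at x)" "P 0 = 0"
    and int3: "integrable M (\<lambda>x. \<bar>W' x - W x\<bar>^3)"
  shows "\<bar>expectation (\<lambda>x. h (W x)) - P T\<bar>
    \<le> 2 * K1 * expectation (\<lambda>x. \<bar>W x - C x / (2 * a)\<bar>)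
      + (K1 * expectation (\<lambda>x. \<bar>R x\<bar>)
         + (K2 + 4 * K1) / 3 * expectation (\<lambda>x. \<bar>W' x - W x\<bar>^3)) / a"
    (is "_ \<le> ?B")
proof (rule field_le_epsilon)
  fix e :: real
  assume "0 < e"
  have K1: "0 \<le> K1" using h'_bounds[of 0] by linarith
  \<comment> \<open>The summand 1 keeps the denominator positive when \<open>K1\<close> is
    zero.\<close>
  define \<epsilon> where "\<epsilon> = e / (4 * K1 + 1)"
  have "0 < \<epsilon>" using \<open>0 < e\<close> K1 by (simp add: \<epsilon>_def)
  have "\<epsilon> * (4 * K1 + 1) = e" using K1 by (simp add: \<epsilon>_def)
  then have eps: "\<epsilon> * (4 * K1) \<le> e" using \<open>0 < \<epsilon>\<close> by (simp add: algebra_simps)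
  obtain g g' g'' where [measurable]: "g \<in> borel_measurable borel" "g' \<in> borel_measurable borel"
    and g: "\<And>x. 0 < x \<Longrightarrow> (g has_real_derivative g' x) (at x)"
    and g': "\<And>x. 0 < x \<Longrightarrow> (g' has_real_derivative g'' x) (at x)"
    and stein: "\<And>x. 0 < x \<Longrightarrow> x * g' x - (x - 1) * g x = h x - P T"
    and g_bound: "\<And>x. 0 < x \<Longrightarrow> \<bar>g x\<bar> \<le> K1"
    and g'_bound: "\<And>x. 0 < x \<Longrightarrow> \<bar>g' x\<bar> \<le> 2 * K1"
    and g''_bound: "\<And>x. 0 < x \<Longrightarrow> \<bar>g'' x\<bar> \<le> 2 * (K2 + 4 * K1)"
    using exponential_stein_solution[OF h h' h'_bounds h''_bound T P] by blast
  have [measurable]: "h \<in> borel_measurable borel"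
    using h by (auto intro!: borel_measurable_continuous_onI DERIV_isCont simp: continuous_on_eq_continuous_at)
  define X where "X x = \<epsilon> + \<bar>W x\<bar>" for x
  have [measurable]: "X \<in> borel_measurable M" unfolding X_def by measurable
  have pos: "0 < X x" for x using \<open>0 < \<epsilon>\<close> by (simp add: X_def add_pos_nonneg)
  have int_h: "integrable M (\<lambda>x. h (Y x))" if [measurable]: "Y \<in> borel_measurable M" for Y
    by (rule integrable_const_bound[of _ 1]) (use h_bounds in auto)
  have int_gW: "integrable M (\<lambda>x. W x * g' (X x) - (W x - 1) * g (X x))"
    using integrable_bounded_mult[of "\<lambda>x. g' (X x)" M "2 * K1" W] integrable_bounded_mult[of "\<lambda>x. g (X x)" M K1 "\<lambda>x. W x - 1"]
      g_bound[OF pos] g'_bound[OF pos] integrable_W by (auto simp: mult.commute)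
  have int_g: "integrable M (\<lambda>x. \<epsilon> * (g' (X x) - g (X x)))"
  proof (rule integrable_const_bound)
    have "\<bar>\<epsilon> * (g' (X x) - g (X x))\<bar> \<le> \<epsilon> * (3 * K1)" for x
      using g_bound[OF pos, of x] g'_bound[OF pos, of x] \<open>0 < \<epsilon>\<close> by (simp add: abs_mult)
    then show "AE x in M. norm (\<epsilon> * (g' (X x) - g (X x))) \<le> \<epsilon> * (3 * K1)" by simp
  qed simp
  have "\<bar>expectation (\<lambda>x. h (W x) - h (X x) + \<epsilon> * (g' (X x) - g (X x)))\<bar> \<le> \<epsilon> * (4 * K1)"
  proof -
    have "AE x in M. \<bar>h (W x) - h (X x) + \<epsilon> * (g' (X x) - g (X x))\<bar> \<le> \<epsilon> * (4 * K1)"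
      using W_nonneg
    proof eventually_elim
      case (elim x)
      have "norm (h (W x) - h (X x)) \<le> K1 * norm (W x - X x)"
      proof (rule field_differentiable_bound[of UNIV h h'])
        show "norm (h' z) \<le> K1" for z using h'_bounds[of z] K1 by (simp add: abs_le_iff)
      qed (use h in auto)
      then have "\<bar>h (W x) - h (X x)\<bar> \<le> \<epsilon> * K1"
        using elim \<open>0 < \<epsilon>\<close> by (simp add: X_def mult.commute)
      moreover have "\<bar>\<epsilon> * (g' (X x) - g (X x))\<bar> \<le> \<epsilon> * (3 * K1)"
        using g_bound[OF pos, of x] g'_bound[OF pos, of x] \<open>0 < \<epsilon>\<close> by (simp add: abs_mult)
      ultimately show ?case by linarith
    qed
    then have "(\<integral>x. \<bar>h (W x) - h (X x) + \<epsilon> * (g' (X x) - g (X x))\<bar> \<partial>M) \<le> (\<integral>x. \<epsilon> * (4 * K1) \<partial>M)"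
      using int_g int_h by (intro integral_mono_AE) auto
    then show ?thesis
      by (intro order_trans[OF integral_abs_bound]) (simp add: prob_space)
  qed
  \<comment> \<open>The Stein equation is used at X = \<epsilon> + W; writing W = X - \<epsilon> in
    the coefficients produces the correction \<epsilon> (g' - g).\<close>
  moreover have "expectation (\<lambda>x. h (W x)) - P T
      = expectation (\<lambda>x. W x * g' (X x) - (W x - 1) * g (X x))
        + expectation (\<lambda>x. h (W x) - h (X x) + \<epsilon> * (g' (X x) - g (X x)))"
  proof -
    have "expectation (\<lambda>x. h (W x)) - P T = expectation (\<lambda>x. h (W x) - P T)"
      using int_h by (simp add: prob_space)
    also have "\<dots> = expectation (\<lambda>x. (W x * g' (X x) - (W x - 1) * g (X x))
        + (h (W x) - h (X x) + \<epsilon> * (g' (X x) - g (X x))))"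
    proof (rule integral_cong_AE)
      show "AE x in M. h (W x) - P T = (W x * g' (X x) - (W x - 1) * g (X x))
        + (h (W x) - h (X x) + \<epsilon> * (g' (X x) - g (X x)))"
        using W_nonneg
      proof eventually_elim
        case (elim x)
        then have "X x = \<epsilon> + W x" by (simp add: X_def)
        with stein[OF pos, of x] show ?case by (simp add: algebra_simps)
      qed
    qed auto
    also have "\<dots> = expectation (\<lambda>x. W x * g' (X x) - (W x - 1) * g (X x))
        + expectation (\<lambda>x. h (W x) - h (X x) + \<epsilon> * (g' (X x) - g (X x)))"
      using int_gW int_g int_h by (intro Bochner_Integration.integral_add) auto
    finally show ?thesis .
  qed
  moreover have "\<bar>expectation (\<lambda>x. W x * g' (X x) - (W x - 1) * g (X x))\<bar> \<le> ?B"
  proof -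
    have K: "2 * (K2 + 4 * K1) / 6 = (K2 + 4 * K1) / 3" by simp
    show ?thesis
      unfolding X_def K[symmetric]
      by (rule stein_identity_bound[OF _ _ g g' g_bound g'_bound g''_bound \<open>0 < \<epsilon>\<close> int3]) auto
  qed
  ultimately show "\<bar>expectation (\<lambda>x. h (W x)) - P T\<bar> \<le> ?B + e"
    using eps by linarith
qed

section \<open>From smooth test functions to the distribution function\<close>

lemma cdf_bounds:
  fixes t \<delta> :: real
  assumes "0 \<le> t" "0 < \<delta>" and int3: "integrable M (\<lambda>x. \<bar>W' x - W x\<bar>^3)"
  shows "\<bar>prob {x \<in> space M. W x \<le> t} - (1 - exp (- t))\<bar>
    \<le> 4 / \<delta> * expectation (\<lambda>x. \<bar>W x - C x / (2 * a)\<bar>)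
      + (2 / \<delta> * expectation (\<lambda>x. \<bar>R x\<bar>)
         + (2 * pi / \<delta>\<^sup>2 + 8 / \<delta>) / 3 * expectation (\<lambda>x. \<bar>W' x - W x\<bar>^3)) / a + \<delta> / 2"
    (is "\<bar>?p - _\<bar> \<le> ?B + _")
proof -
  let ?E = "{x \<in> space M. W x \<le> t}"
  have p: "?p = expectation (indicator ?E)" by simp
  have int_E: "integrable M (indicator ?E :: 'a \<Rightarrow> real)"
    by (intro integrable_real_indicator) (auto simp: emeasure_eq_measure)
  have cont_integrable: "integrable M (\<lambda>x. h (W x))"
    if "\<And>x. (h has_real_derivative h' x) (at x)" "\<And>x. 0 \<le> h x" "\<And>x. h x \<le> 1" for h h' :: "real \<Rightarrow> real"
  proof -
    have [measurable]: "h \<in> borel_measurable borel"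
      using that(1) by (auto intro!: borel_measurable_continuous_onI DERIV_isCont simp: continuous_on_eq_continuous_at)
    show ?thesis by (rule integrable_const_bound[of _ 1]) (use that in auto)
  qed
  have "?p \<le> 1 - exp (- t) + \<delta> / 2 + ?B"
  proof -
    \<comment> \<open>The descent over [t, t + \<delta>] makes \<open>h\<close> dominate the
      indicator.\<close>
    obtain h h' h'' P :: "real \<Rightarrow> real" where
      h: "\<And>x. (h has_real_derivative h' x) (at x)" "\<And>x. (h' has_real_derivative h'' x) (at x)"
      "\<And>x. - (2 / \<delta>) \<le> h' x" "\<And>x. h' x \<le> 0" "\<And>x. \<bar>h'' x\<bar> \<le> 2 * pi / \<delta>\<^sup>2"
      and h1: "\<And>x. x \<le> t \<Longrightarrow> h x = 1" and h0: "\<And>x. t + \<delta> \<le> x \<Longrightarrow> h x = 0"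
      and h_bounds: "\<And>x. 0 \<le> h x" "\<And>x. h x \<le> 1"
      and P: "\<And>x. (P has_real_derivative h x * exp (- x)) (at x)" "P 0 = 0"
      and P_le: "P (t + \<delta>) \<le> 1 - exp (- t) + \<delta> / 2"
      using smooth_step[OF \<open>0 < \<delta>\<close>, of t] \<open>0 \<le> t\<close> by metis
    have "?p \<le> expectation (\<lambda>x. h (W x))"
      unfolding p
      by (rule integral_mono[OF int_E cont_integrable[OF h(1) h_bounds]])
        (use h1 h_bounds in \<open>auto simp: indicator_def\<close>)
    also have "\<dots> \<le> P (t + \<delta>) + ?B"
      using smooth_expectation_bound[where T = "t + \<delta>", OF h h_bounds _ _ P int3] h0 assms by simp
    finally show ?thesis using P_le by linarith
  qed
  moreover have "1 - exp (- t) - \<delta> / 2 - ?B \<le> ?p"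
  proof -
    \<comment> \<open>The descent over [t - \<delta>, t] puts \<open>h\<close> below the indicator.
      Its start may be negative, which the lower estimate for \<open>P\<close> allows.\<close>
    obtain h h' h'' P :: "real \<Rightarrow> real" where
      h: "\<And>x. (h has_real_derivative h' x) (at x)" "\<And>x. (h' has_real_derivative h'' x) (at x)"
      "\<And>x. - (2 / \<delta>) \<le> h' x" "\<And>x. h' x \<le> 0" "\<And>x. \<bar>h'' x\<bar> \<le> 2 * pi / \<delta>\<^sup>2"
      and h0: "\<And>x. t \<le> x \<Longrightarrow> h x = 0"
      and h_bounds: "\<And>x. 0 \<le> h x" "\<And>x. h x \<le> 1"
      and P: "\<And>x. (P has_real_derivative h x * exp (- x)) (at x)" "P 0 = 0"
      and P_ge: "1 - exp (- t) - \<delta> / 2 \<le> P t"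
      using smooth_step[OF \<open>0 < \<delta>\<close>, of "t - \<delta>"] \<open>0 \<le> t\<close> unfolding diff_add_cancel by metis
    have "P t \<le> expectation (\<lambda>x. h (W x)) + ?B"
      using smooth_expectation_bound[where T = t, OF h h_bounds _ _ P int3] h0 assms by simp
    also have "expectation (\<lambda>x. h (W x)) \<le> ?p"
      unfolding p
      by (rule integral_mono[OF cont_integrable[OF h(1) h_bounds] int_E])
        (use h0 h_bounds in \<open>auto simp: indicator_def\<close>)
    finally show ?thesis using P_ge by linarith
  qed
  ultimately show ?thesis by (simp only: abs_le_iff) linarith
qed

lemma kolmogorov_dist_exponential_le:
  fixes N :: "'b measure" and Z :: "'b \<Rightarrow> real" and \<delta> :: real
  assumes "prob_space N" and Z: "distributed N lborel Z (exponential_density 1)"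
    and "0 < \<delta>" and int3: "integrable M (\<lambda>x. \<bar>W' x - W x\<bar>^3)"
  shows "kolmogorov_dist M W N Z
    \<le> 4 / \<delta> * expectation (\<lambda>x. \<bar>W x - C x / (2 * a)\<bar>)
      + (2 / \<delta> * expectation (\<lambda>x. \<bar>R x\<bar>)
         + (2 * pi / \<delta>\<^sup>2 + 8 / \<delta>) / 3 * expectation (\<lambda>x. \<bar>W' x - W x\<bar>^3)) / a + \<delta> / 2"
    (is "_ \<le> ?B")
  unfolding kolmogorov_dist_def
proof (rule cSUP_least)
  interpret N: prob_space N by fact
  fix t :: real
  have [measurable]: "Z \<in> borel_measurable N" using distributed_measurable[OF Z] by simp
  have Z_cdf: "N.prob {y \<in> space N. Z y \<le> t} = 1 - exp (- t)" if "0 \<le> t" for t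
    using N.exponential_distributedD_le[OF Z that] by simp
  show "\<bar>prob {x \<in> space M. W x \<le> t} - N.prob {y \<in> space N. Z y \<le> t}\<bar> \<le> ?B"
  proof (cases "0 \<le> t")
    case True
    then show ?thesis using cdf_bounds[OF True \<open>0 < \<delta>\<close> int3] Z_cdf by simp
  next
    \<comment> \<open>For negative t both distribution functions vanish, so only the sign of the
      bound matters.\<close>
    case False
    have "N.prob {y \<in> space N. Z y \<le> t} \<le> N.prob {y \<in> space N. Z y \<le> 0}"
      using False by (intro N.finite_measure_mono) auto
    then have "N.prob {y \<in> space N. Z y \<le> t} = 0"
      using Z_cdf[of 0] by (simp add: order_antisym)
    moreover have "prob {x \<in> space M. W x \<le> t} = 0"
      using False W_nonneg by (subst prob_eq_0) (auto elim: AE_mp)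
    moreover have "0 \<le> ?B"
      using \<open>0 < \<delta>\<close> a_pos pi_gt_zero
      by (intro add_nonneg_nonneg mult_nonneg_nonneg divide_nonneg_nonneg integral_nonneg) auto
    ultimately show ?thesis by simp
  qed
qed simp

end

section \<open>Comparison of constants and the case of an infinite third moment\<close>

theorem theorem1p1:
  fixes M F :: "'a measure" and N :: "'b measure"
    and W W' R :: "'a \<Rightarrow> real" and Z :: "'b \<Rightarrow> real" and a \<delta> :: real
  assumes "prob_space M" and "prob_space N"
    and "distributed N lborel Z (\<lambda>z. ennreal (exponential_density 1 z))"
    and "W \<in> borel_measurable M" and "AE x in M. W x \<ge> 0"
    and "integrable M (\<lambda>x. (W x)^2)"
    and "exchangeable_pair M W W'"
    and "a > 0"
    and "subalgebra M F"
    and "subalgebra F (vimage_algebra (space M) W borel)"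
    and "R \<in> borel_measurable M"
    and "AE x in M. real_cond_exp M F (\<lambda>y. W' y - W y) x = - a * (W x - 1) + R x"
    and "\<delta> > 0"
  shows "ennreal (kolmogorov_dist M W N Z) \<le>
      ennreal (8 / \<delta>) *
        nn_expectation M (\<lambda>x. \<bar>W x - real_cond_exp M F (\<lambda>y. (W' y - W y)^2) x / (2 * a)\<bar>)
    + ennreal (2 / \<delta> * \<bar>prob_space.expectation M W - 1\<bar>)
    + ennreal ((5 - 6 / exp 1) / \<delta> + 3 / \<delta>^2) *
        (nn_expectation M (\<lambda>x. \<bar>W' x - W x\<bar>^3) / ennreal a)
    + ennreal (8 / \<delta>) * (nn_expectation M (\<lambda>x. \<bar>R x\<bar>) / ennreal a)
    + ennreal (\<delta> / 2)"
proof -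
  interpret exchangeable_regression M F W W' R a
    using assms by (simp add: exchangeable_regression_def exchangeable_regression_axioms_def)
  define A where "A = expectation (\<lambda>x. \<bar>W x - C x / (2 * a)\<bar>)"
  define r where "r = expectation (\<lambda>x. \<bar>R x\<bar>)"
  define m where "m = \<bar>expectation W - 1\<bar>"
  let ?c = "(5 - 6 / exp 1) / \<delta> + 3 / \<delta>^2"
  \<comment> \<open>From exp (1/2) >= 1 + 1/2 + 1/8 follows e >= 169/64 >= 18/7. Hence 5 - 6/e >=
    8/3, and 8/3 is the coefficient of 1/\<delta> that the smoothing argument produces for the third
    moment.\<close>
  have "(13 / 8)\<^sup>2 \<le> exp (1 / 2 :: real) ^ 2"
    using exp_lower_Taylor_quadratic[of "1 / 2"] by (intro power_mono) (auto simp: power2_eq_square)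
  then have "18 / 7 \<le> exp (1 :: real)"
    by (simp add: power2_eq_square flip: exp_add)
  then have e: "6 / exp 1 \<le> (7 / 3 :: real)" by (simp add: field_simps)
  have c_pos: "0 < ?c"
    using e \<open>0 < \<delta>\<close> by (intro add_pos_pos divide_pos_pos) auto
  show ?thesis
  proof (cases "integrable M (\<lambda>x. \<bar>W' x - W x\<bar>^3)")
    \<comment> \<open>The third moment is then infinite and its coefficient positive, so the
      right-hand side is infinite.\<close>
    case False
    have "nn_expectation M (\<lambda>x. \<bar>W' x - W x\<bar>^3) = \<infinity>"
    proof (rule ccontr)
      assume "nn_expectation M (\<lambda>x. \<bar>W' x - W x\<bar>^3) \<noteq> \<infinity>"
      then have "integrable M (\<lambda>x. \<bar>W' x - W x\<bar>^3)"
        unfolding nn_expectation_def by (intro integrableI_nonneg) (auto simp: top.not_eq_extremum)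
      with False show False ..
    qed
    then show ?thesis
      using c_pos by (simp add: ennreal_top_divide ennreal_mult_top)
  next
    case True
    define d where "d = expectation (\<lambda>x. \<bar>W' x - W x\<bar>^3)"
    have nonneg: "0 \<le> A" "0 \<le> r" "0 \<le> d" "0 \<le> m"
      by (auto simp: A_def r_def d_def m_def)
    have nn: "nn_expectation M (\<lambda>x. \<bar>W x - real_cond_exp M F (\<lambda>y. (W' y - W y)^2) x / (2 * a)\<bar>) = ennreal A"
      "nn_expectation M (\<lambda>x. \<bar>W' x - W x\<bar>^3) = ennreal d"
      "nn_expectation M (\<lambda>x. \<bar>R x\<bar>) = ennreal r"
      unfolding nn_expectation_def A_def d_def r_def C_def[symmetric]
      using integrable_W integrable_C integrable_R True
      by (auto intro!: nn_integral_eq_integral)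
    \<comment> \<open>The bound already proved is compared term by term with the claimed one: 4 and
      2 against 8, 2 pi / 3 against 3, and 8/3 against 5 - 6/e.\<close>
    have "4 / \<delta> * A \<le> 8 / \<delta> * A"
      using nonneg \<open>0 < \<delta>\<close> by (intro mult_right_mono divide_right_mono) auto
    moreover have "2 / \<delta> * r / a \<le> 8 / \<delta> * (r / a)"
      using nonneg \<open>0 < \<delta>\<close> \<open>0 < a\<close> by (simp add: field_simps)
    moreover have "(2 * pi / \<delta>\<^sup>2 + 8 / \<delta>) / 3 * (d / a) \<le> ?c * (d / a)"
    proof (rule mult_right_mono)
      have "2 * pi / 3 / \<delta>\<^sup>2 \<le> 3 / \<delta>\<^sup>2"
        using pi_less_4 by (intro divide_right_mono) auto
      moreover have "8 / 3 / \<delta> \<le> (5 - 6 / exp 1) / \<delta>"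
        using e \<open>0 < \<delta>\<close> by (intro divide_right_mono) auto
      ultimately show "(2 * pi / \<delta>\<^sup>2 + 8 / \<delta>) / 3 \<le> ?c"
        by (simp add: add_divide_distrib)
    qed (use nonneg \<open>0 < a\<close> in simp)
    moreover have "0 \<le> 2 / \<delta> * m" using nonneg \<open>0 < \<delta>\<close> by simp
    moreover have "kolmogorov_dist M W N Z
      \<le> 4 / \<delta> * A + (2 / \<delta> * r / a + (2 * pi / \<delta>\<^sup>2 + 8 / \<delta>) / 3 * (d / a)) + \<delta> / 2"
      using kolmogorov_dist_exponential_le[OF assms(2,3) \<open>0 < \<delta>\<close> True]
      by (simp add: A_def r_def d_def add_divide_distrib)
    ultimately have "kolmogorov_dist M W N Z
      \<le> 8 / \<delta> * A + 2 / \<delta> * m + ?c * (d / a) + 8 / \<delta> * (r / a) + \<delta> / 2"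
      by linarith
    then have "ennreal (kolmogorov_dist M W N Z)
      \<le> ennreal (8 / \<delta> * A + 2 / \<delta> * m + ?c * (d / a) + 8 / \<delta> * (r / a) + \<delta> / 2)"
      by (rule ennreal_leI)
    also have "\<dots> = ennreal (8 / \<delta> * A) + ennreal (2 / \<delta> * m) + ennreal (?c * (d / a))
      + ennreal (8 / \<delta> * (r / a)) + ennreal (\<delta> / 2)"
      using nonneg c_pos \<open>0 < \<delta>\<close> \<open>0 < a\<close> by (simp add: ennreal_plus)
    also have "\<dots> = ennreal (8 / \<delta>) * ennreal A + ennreal (2 / \<delta> * m) + ennreal ?c * (ennreal d / ennreal a)
      + ennreal (8 / \<delta>) * (ennreal r / ennreal a) + ennreal (\<delta> / 2)"
      using nonneg c_pos \<open>0 < \<delta>\<close> \<open>0 < a\<close>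
      by (simp add: ennreal_mult divide_ennreal del: times_divide_eq_left times_divide_eq_right times_divide_times_eq)
    finally show ?thesis
      unfolding nn m_def .
  qed
qed

end
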